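(* Let $n\ge 2$, let $c>0$ be a constant, and let $\phi(t)=ct$ for $t\in[0,+\infty)$. Then the $\phi$-rigidity property holds in $\mathbb{R}^n$.
   Context: Points of $\mathbb{R}^n$ are written $x=(x_1,\dots,x_n)$. Let $\phi:[0,+\infty)\to[0,+\infty)$ be a convex function such that $\phi(t)=0$ if and only if $t=0$. We say that the $\phi$-rigidity property holds in $\mathbb{R}^n$ if, for any vector field $\eta=(\eta_1,\dots,\eta_n)\in L^\infty(\mathbb{R}^n;\mathbb{R}^n)$ such that (i) $\eta=0$ (almost everywhere) on $\{x\in\mathbb{R}^n: x_n<0\}$; (ii) $\operatorname{div}\eta=0$ on $\mathbb{R}^n$ in the distributional sense; (iii) $\eta_n\ge\phi(|\eta|)$ almost everywhere on $\mathbb{R}^n$; one has $\eta=0$ almost everywhere on $\mathbb{R}^n$. *)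

theory Defs
  imports "HOL-Analysis.Analysis"
begin

text \<open>
  Points of \<open>\<real>\<^sup>n\<close> are vectors \<open>x :: real ^ 'n\<close> with \<open>n = CARD('n)\<close>.  The index type is linearly
  ordered, so that there is a last coordinate \<open>x\<^sub>n\<close>.
\<close>

definition last_index :: "'n::{finite,linorder}" where
  "last_index = Max UNIV"

definition partial :: "'n::finite \<Rightarrow> (real ^ 'n \<Rightarrow> real) \<Rightarrow> (real ^ 'n \<Rightarrow> real)" where
  "partial i f x = frechet_derivative f (at x) (axis i 1)"

definition gradient :: "(real ^ 'n::finite \<Rightarrow> real) \<Rightarrow> (real ^ 'n \<Rightarrow> real ^ 'n)" where
  "gradient f x = (\<chi> i. partial i f x)"

text \<open>
  \<open>C\<^sup>\<infinity>(\<real>\<^sup>n)\<close>: every iterated partial derivative (including \<open>f\<close> itself, for the empty list of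
  indices) is differentiable at every point, and hence also continuous.
\<close>

definition smooth :: "(real ^ 'n::finite \<Rightarrow> real) \<Rightarrow> bool" where
  "smooth f \<longleftrightarrow> (\<forall>is :: 'n list. \<forall>x. foldr partial is f differentiable (at x))"

definition test_function :: "(real ^ 'n::finite \<Rightarrow> real) \<Rightarrow> bool" where
  "test_function \<psi> \<longleftrightarrow> smooth \<psi> \<and> compact (closure {x. \<psi> x \<noteq> 0})"

definition L_infinity :: "(real ^ 'n::finite \<Rightarrow> real ^ 'n) set" where
  "L_infinity =
     {\<eta>. \<eta> \<in> borel_measurable lebesgue \<and> (\<exists>C. AE x in lebesgue. norm (\<eta> x) \<le> C)}"

text \<open>
  The distribution \<open>div \<eta>\<close>, as a functional on test functions.  For \<open>\<eta> \<in> L\<^sup>\<infinity>\<close> the integrand is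
  integrable for every test function.
\<close>

definition distr_div :: "(real ^ 'n::finite \<Rightarrow> real ^ 'n) \<Rightarrow> (real ^ 'n \<Rightarrow> real) \<Rightarrow> real" where
  "distr_div \<eta> \<psi> = - (LINT x|lebesgue. \<eta> x \<bullet> gradient \<psi> x)"

text \<open>
  The standing assumption on \<open>\<phi> : [0,\<infinity>) \<rightarrow> [0,\<infinity>)\<close>; values of \<open>\<phi>\<close> at negative arguments are
  irrelevant.
\<close>

definition admissible :: "(real \<Rightarrow> real) \<Rightarrow> bool" where
  "admissible \<phi> \<longleftrightarrow>
     convex_on {0..} \<phi> \<and> (\<forall>t\<ge>0. \<phi> t \<ge> 0) \<and> (\<forall>t\<ge>0. \<phi> t = 0 \<longleftrightarrow> t = 0)"

lemma admissible_linear: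
  fixes c :: real
  assumes "c > 0" and "\<And>t. t \<ge> 0 \<Longrightarrow> \<phi> t = c * t"
  shows "admissible \<phi>"
  unfolding admissible_def
proof (intro conjI)
  show "convex_on {0..} \<phi>"
  proof (rule convex_onI)
    fix t x y :: real
    assume *: "0 < t" "t < 1" "x \<in> {0..}" "y \<in> {0..}"
    then have "(1 - t) * x + t * y \<ge> 0" by simp
    with * show "\<phi> ((1 - t) *\<^sub>R x + t *\<^sub>R y) \<le> (1 - t) * \<phi> x + t * \<phi> y"
      using assms(2)[of x] assms(2)[of y] assms(2)[of "(1 - t) * x + t * y"]
      by (simp add: algebra_simps)
  qed simp
qed (use assms in auto)

text \<open>
  The \<open>\<phi>\<close>-rigidity property in \<open>\<real>\<^sup>n\<close>, a notion for admissible \<open>\<phi>\<close>; the type argument supplies the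
  dimension \<open>n = CARD('n)\<close>.
\<close>

definition phi_rigidity :: "'n::{finite,linorder} itself \<Rightarrow> (real \<Rightarrow> real) \<Rightarrow> bool" where
  "phi_rigidity (_ :: 'n::{finite,linorder} itself) \<phi> \<longleftrightarrow>
     (\<forall>\<eta> :: real ^ 'n::{finite,linorder} \<Rightarrow> real ^ 'n::{finite,linorder}.
        \<eta> \<in> L_infinity \<longrightarrow>
        (AE x in lebesgue. x $ last_index < 0 \<longrightarrow> \<eta> x = 0) \<longrightarrow>
        (\<forall>\<psi>. test_function \<psi> \<longrightarrow> distr_div \<eta> \<psi> = 0) \<longrightarrow>
        (AE x in lebesgue. \<eta> x $ last_index \<ge> \<phi> (norm (\<eta> x))) \<longrightarrow>
        (AE x in lebesgue. \<eta> x = 0))"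

end

theory Submission
  imports Defs
begin

text \<open>
  For \<open>K > 0\<close> the ball \<open>{x. \<bar>x\<bar>\<^sup>2 + 2 K x\<^sub>n < (K c / 2)\<^sup>2}\<close>, centred at \<open>- K e\<^sub>n\<close>, meets
  \<open>{x\<^sub>n \<ge> 0}\<close> only at points with \<open>\<bar>x\<bar> < K c / 2\<close>.  There the outer normal direction \<open>x + K e\<^sub>n\<close>
  satisfies \<open>\<eta> \<bullet> (x + K e\<^sub>n) \<ge> K \<eta>\<^sub>n - \<bar>x\<bar> \<bar>\<eta>\<bar> \<ge> (K c / 2) \<bar>\<eta>\<bar>\<close>.  Testing \<open>div \<eta> = 0\<close> against a radial
  bump of this ball, whose gradient is a nonpositive multiple of \<open>x + K e\<^sub>n\<close>, therefore gives the
  integral of a function of constant sign, and \<open>\<eta>\<close> vanishes in the ball.  As \<open>K \<rightarrow> \<infinity>\<close> the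
  balls cover \<open>\<real>\<^sup>n\<close>.
\<close>

section \<open>Flat exponentials of one variable\<close>

text \<open>The case \<open>m = 0\<close> is the classical smooth profile \<open>exp (- 1/t)\<close>
  extended by zero. The extra powers of \<open>1/t\<close> make the span of the family closed under
  differentiation.\<close>

definition flat_exp :: "nat \<Rightarrow> real \<Rightarrow> real" where
  "flat_exp m t = (if t \<le> 0 then 0 else exp (- inverse t) * inverse t ^ m)"

lemma flat_exp_nonneg: "flat_exp m t \<ge> 0"
  by (simp add: flat_exp_def)

lemma flat_exp_pos: "t > 0 \<Longrightarrow> flat_exp m t > 0"
  by (simp add: flat_exp_def)

lemma flat_exp_eq_0: "t \<le> 0 \<Longrightarrow> flat_exp m t = 0"
  by (simp add: flat_exp_def)

lemma flat_exp_tendsto_0: "(flat_exp m \<longlongrightarrow> 0) (at 0)"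
proof (rule filterlim_split_at)
  show "(flat_exp m \<longlongrightarrow> 0) (at_left 0)"
    by (rule tendsto_eventually) (auto simp: eventually_at_filter flat_exp_def)
  have "((\<lambda>t::real. inverse t ^ m / exp (inverse t)) \<longlongrightarrow> 0) (at_right 0)"
    by (rule filterlim_compose[OF tendsto_power_div_exp_0 filterlim_inverse_at_top_right])
  then show "(flat_exp m \<longlongrightarrow> 0) (at_right 0)"
    by (rule Lim_transform_eventually)
      (auto simp: eventually_at_filter flat_exp_def exp_minus divide_inverse)
qed

lemma flat_exp_has_real_derivative:
  "(flat_exp m has_real_derivative flat_exp (m + 2) t - real m * flat_exp (m + 1) t) (at t)"
proof -
  consider "t < 0" | "t = 0" | "t > 0" by linarith
  then show ?thesis
  proof cases
    case 1
    have "((\<lambda>_. 0) has_real_derivative 0) (at t)" by simp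
    then have "(flat_exp m has_real_derivative 0) (at t)"
      by (rule has_field_derivative_transform_within_open[where S = "{..<0}"])
        (use 1 in \<open>auto simp: flat_exp_def\<close>)
    with 1 show ?thesis by (simp add: flat_exp_def)
  next
    case 2
    \<comment> \<open>Away from 0 the difference quotient of \<open>flat_exp m\<close> at 0 is
      exactly \<open>flat_exp (m + 1)\<close>.\<close>
    have "((\<lambda>h. (flat_exp m (0 + h) - flat_exp m 0) / h) \<longlongrightarrow> 0) (at 0)"
      by (rule Lim_transform_eventually[OF flat_exp_tendsto_0[of "m + 1"]])
        (auto simp: eventually_at_filter flat_exp_def divide_inverse)
    then have "(flat_exp m has_real_derivative 0) (at 0)"
      by (simp add: DERIV_def)
    with 2 show ?thesis by (simp add: flat_exp_def)
  next
    case 3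
    have "((\<lambda>t. exp (- inverse t) * inverse t ^ m) has_real_derivative
        exp (- inverse t) * (inverse t * inverse t) * inverse t ^ m
        - exp (- inverse t) * (real m * inverse t ^ (m - 1) * (inverse t * inverse t))) (at t)"
      using 3 by (auto intro!: derivative_eq_intros simp: algebra_simps)
    \<comment> \<open>For \<open>m = 0\<close> the truncated exponent \<open>m - 1\<close> is
      harmless, since its term carries the factor \<open>real m\<close>.\<close>
    also have "exp (- inverse t) * (inverse t * inverse t) * inverse t ^ m
        - exp (- inverse t) * (real m * inverse t ^ (m - 1) * (inverse t * inverse t))
        = flat_exp (m + 2) t - real m * flat_exp (m + 1) t"
      using 3 by (cases m) (simp_all add: flat_exp_def algebra_simps)
    finally show ?thesis
      by (rule has_field_derivative_transform_within_open[where S = "{0<..}"])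
        (use 3 in \<open>auto simp: flat_exp_def\<close>)
  qed
qed

section \<open>A class of smooth functions closed under partial derivatives\<close>

lemma partial_eqI: "(f has_derivative f') (at x) \<Longrightarrow> partial i f x = f' (axis i 1)"
  unfolding partial_def by (metis frechet_derivative_at)

text \<open>Smoothness quantifies over all iterated partial derivatives. A class of differentiable
  functions that is closed under \<open>partial i\<close> settles it by induction on the list of
  indices.\<close>

inductive flat_elementary :: "(real ^ 'n::finite \<Rightarrow> real) \<Rightarrow> bool" where
  const: "flat_elementary (\<lambda>_. a)"
| coord: "flat_elementary (\<lambda>x. x $ j)"
| add: "flat_elementary f \<Longrightarrow> flat_elementary g \<Longrightarrow> flat_elementary (\<lambda>x. f x + g x)"
| mult: "flat_elementary f \<Longrightarrow> flat_elementary g \<Longrightarrow> flat_elementary (\<lambda>x. f x * g x)"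
| flat_exp: "flat_elementary f \<Longrightarrow> flat_elementary (\<lambda>x. flat_exp m (f x))"

text \<open>The sum, product and chain rules build each derivative from the functions and
  derivatives of the parts, so for a fixed direction \<open>v\<close> the result stays in the
  class.\<close>

lemma flat_elementary_has_derivative:
  assumes "flat_elementary f"
  shows "\<exists>D. (\<forall>x. (f has_derivative D x) (at x)) \<and> (\<forall>v. flat_elementary (\<lambda>x. D x v))"
  using assms
proof induction
  case (const a)
  show ?case
    by (rule exI[of _ "\<lambda>x v. 0"]) (auto intro: flat_elementary.const)
next
  case (coord j)
  show ?case
    by (rule exI[of _ "\<lambda>x v. v $ j"])
      (auto intro: flat_elementary.const bounded_linear_imp_has_derivative bounded_linear_vec_nth)
next
  case (add f g)
  then obtain D E where
    "\<And>x. (f has_derivative D x) (at x)" "\<And>v. flat_elementary (\<lambda>x. D x v)"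
    "\<And>x. (g has_derivative E x) (at x)" "\<And>v. flat_elementary (\<lambda>x. E x v)"
    by blast
  then show ?case
    by (intro exI[of _ "\<lambda>x v. D x v + E x v"])
      (auto intro: flat_elementary.intros has_derivative_add)
next
  case (mult f g)
  then obtain D E where
    "\<And>x. (f has_derivative D x) (at x)" "\<And>v. flat_elementary (\<lambda>x. D x v)"
    "\<And>x. (g has_derivative E x) (at x)" "\<And>v. flat_elementary (\<lambda>x. E x v)"
    by blast
  with mult.hyps show ?case
    by (intro exI[of _ "\<lambda>x v. f x * E x v + D x v * g x"] conjI allI has_derivative_mult
        flat_elementary.add flat_elementary.mult)
next
  case (flat_exp f m)
  then obtain D where D:
    "\<And>x. (f has_derivative D x) (at x)" "\<And>v. flat_elementary (\<lambda>x. D x v)"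
    by blast
  \<comment> \<open>The difference is written as a sum with a constant multiple, because the class
    has rules for sums and products only.\<close>
  let ?E = "\<lambda>x v. D x v * (flat_exp (m + 2) (f x) + - real m * flat_exp (m + 1) (f x))"
  have "((\<lambda>x. flat_exp m (f x)) has_derivative ?E x) (at x)" for x
    using DERIV_compose_FDERIV[OF flat_exp_has_real_derivative D(1)] by simp
  moreover have "flat_elementary (\<lambda>x. ?E x v)" for v
    by (intro flat_elementary.intros flat_exp.hyps D(2))
  ultimately show ?case
    by (intro exI[of _ ?E] conjI allI)
qed

lemma flat_elementary_partial:
  assumes "flat_elementary f"
  shows "flat_elementary (partial i f)"
proof -
  obtain D where "\<And>x. (f has_derivative D x) (at x)" "\<And>v. flat_elementary (\<lambda>x. D x v)"
    using flat_elementary_has_derivative[OF assms] by blast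
  moreover from this have "partial i f = (\<lambda>x. D x (axis i 1))"
    by (intro ext partial_eqI)
  ultimately show ?thesis by simp
qed

lemma flat_elementary_smooth:
  assumes "flat_elementary f"
  shows "smooth f"
  unfolding smooth_def
proof (intro allI)
  fix js x
  have "flat_elementary (foldr partial js f)"
    by (induction js) (simp_all add: assms flat_elementary_partial)
  then show "foldr partial js f differentiable (at x)"
    using flat_elementary_has_derivative differentiable_def by blast
qed

lemma flat_elementary_sum:
  assumes "finite A" "\<And>i. i \<in> A \<Longrightarrow> flat_elementary (f i)"
  shows "flat_elementary (\<lambda>x. \<Sum>i\<in>A. f i x)"
  using assms by (induction) (auto intro: flat_elementary.intros)

section \<open>The balls and their bump functions\<close>

text \<open>Completing the square gives \<open>K^2 + (K * c / 2)^2 - |x + K e_j|^2\<close>, the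
  squared radius minus the squared distance to the centre. The sphere meets \<open>x $ j = 0\<close>
  where \<open>norm x = K * c / 2\<close>.\<close>

definition ball_fun :: "'n::finite \<Rightarrow> real \<Rightarrow> real \<Rightarrow> real ^ 'n \<Rightarrow> real" where
  "ball_fun j c K x = (K * c / 2)\<^sup>2 - x \<bullet> x - 2 * K * x $ j"

text \<open>Bounds the support of the bump and of its gradient. The estimate follows from
  \<open>x $ j \<ge> - norm x\<close> by completing the square in \<open>norm x\<close>.\<close>

lemma ball_fun_nonneg_imp_norm_le:
  assumes "ball_fun j c K x \<ge> 0" "c > 0" "K > 0"
  shows "norm x \<le> 2 * K + K * c / 2"
proof -
  have "- K * norm x \<le> K * x $ j"
    using assms(3) component_le_norm_cart[of x j]
      mult_left_mono[of "- norm x" "x $ j" K] by simp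
  then have "(norm x - K)\<^sup>2 \<le> (K * c / 2)\<^sup>2 + K\<^sup>2"
    using assms(1) unfolding ball_fun_def dot_square_norm power2_diff
    by (simp add: algebra_simps)
  also have "\<dots> \<le> (K * c / 2 + K)\<^sup>2"
    using assms(2,3) by (simp add: power2_sum)
  finally have "norm x - K \<le> K * c / 2 + K"
    by (rule power2_le_imp_le) (use assms in simp)
  then show ?thesis by simp
qed

lemma flat_elementary_ball_fun: "flat_elementary (ball_fun j c K)"
proof -
  have "ball_fun j c K =
      (\<lambda>x. (K * c / 2)\<^sup>2 + (-1) * (\<Sum>i\<in>UNIV. x $ i * x $ i) + (- 2 * K) * x $ j)"
    by (simp add: ball_fun_def inner_vec_def fun_eq_iff)
  then show ?thesis
    by (simp only:) (intro flat_elementary.const flat_elementary.coord flat_elementary.add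
        flat_elementary.mult flat_elementary_sum finite)
qed

text \<open>For \<open>m = 0\<close> the derivative of \<open>flat_exp m\<close> is
  \<open>flat_exp 2\<close> alone, and \<open>ball_fun\<close> has gradient
  \<open>-2 (x + K e_j)\<close>.\<close>

lemma gradient_flat_exp_ball_fun:
  "gradient (\<lambda>x. flat_exp 0 (ball_fun j c K x)) x =
     (- 2 * flat_exp 2 (ball_fun j c K x)) *\<^sub>R (x + K *\<^sub>R axis j 1)"
proof -
  have "(ball_fun j c K has_derivative (\<lambda>v. - 2 * (x \<bullet> v) - 2 * K * v $ j)) (at x)"
    unfolding ball_fun_def
    by (auto intro!: derivative_eq_intros bounded_linear_imp_has_derivative[OF bounded_linear_vec_nth]
        simp: inner_commute)
  from DERIV_compose_FDERIV[OF flat_exp_has_real_derivative this, of 0]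
  have "((\<lambda>x. flat_exp 0 (ball_fun j c K x)) has_derivative
      (\<lambda>v. (- 2 * (x \<bullet> v) - 2 * K * v $ j) * flat_exp 2 (ball_fun j c K x))) (at x)"
    by (simp add: numeral_2_eq_2)
  from partial_eqI[OF this] show ?thesis
    by (simp add: gradient_def vec_eq_iff inner_axis axis_eq_axis) (simp add: axis_def algebra_simps)
qed

lemma test_function_flat_exp_ball_fun:
  assumes "c > 0" "K > 0"
  shows "test_function (\<lambda>x. flat_exp 0 (ball_fun j c K x))"
proof -
  have "{x. flat_exp 0 (ball_fun j c K x) \<noteq> 0} \<subseteq> cball 0 (2 * K + K * c / 2)"
    using ball_fun_nonneg_imp_norm_le[OF _ assms] flat_exp_eq_0
    by (smt (verit) mem_Collect_eq mem_cball_0 subsetI)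
  then have "bounded {x. flat_exp 0 (ball_fun j c K x) \<noteq> 0}"
    using bounded_cball bounded_subset by blast
  then show ?thesis
    by (simp add: test_function_def flat_elementary_smooth flat_elementary.flat_exp
        flat_elementary_ball_fun)
qed

section \<open>Vanishing of the field in a single ball\<close>

text \<open>A zero integral carries information only for an integrable integrand, as the default
  value of the integral is 0. Here a constant multiple of the indicator of \<open>cball 0 r\<close>
  dominates.\<close>

lemma integrable_inner_L_infinity:
  fixes \<eta> :: "real ^ 'n::finite \<Rightarrow> real ^ 'n"
  assumes "\<eta> \<in> L_infinity" "continuous_on UNIV g" "\<And>x. norm x > r \<Longrightarrow> g x = 0"
  shows "integrable lebesgue (\<lambda>x. \<eta> x \<bullet> g x)"
proof -
  obtain C where \<eta>: "\<eta> \<in> borel_measurable lebesgue" and C: "AE x in lebesgue. norm (\<eta> x) \<le> C"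
    using assms(1) by (auto simp: L_infinity_def)
  have "compact (g ` cball 0 r)"
    using assms(2) by (intro compact_continuous_image) (auto intro: continuous_on_subset)
  then obtain B where B: "\<And>x. norm x \<le> r \<Longrightarrow> norm (g x) \<le> B"
    by (metis bounded_iff compact_imp_bounded imageI mem_cball_0)
  have g: "g \<in> borel_measurable lebesgue"
    using borel_measurable_continuous_onI[OF assms(2)] by (simp add: measurable_completion)
  have "integrable lebesgue (\<lambda>x::real^'n. indicat_real (cball 0 r) x)"
    by (intro integrable_real_indicator) (use emeasure_bounded_finite[OF bounded_cball] in auto)
  then have "integrable lebesgue (\<lambda>x::real^'n. (C * B) * indicat_real (cball 0 r) x)"
    by simp
  then show ?thesis
  proof (rule Bochner_Integration.integrable_bound)
    show "(\<lambda>x. \<eta> x \<bullet> g x) \<in> borel_measurable lebesgue"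
      using \<eta> g by simp
    show "AE x in lebesgue. norm (\<eta> x \<bullet> g x) \<le> norm (C * B * indicat_real (cball 0 r) x)"
      using C
    proof eventually_elim
      case (elim x)
      show ?case
      proof (cases "norm x \<le> r")
        case True
        have "norm (\<eta> x \<bullet> g x) \<le> norm (\<eta> x) * norm (g x)"
          by (simp add: Cauchy_Schwarz_ineq2)
        also have "\<dots> \<le> C * B"
          using elim B[OF True] by (intro mult_mono) (auto intro: order_trans[OF norm_ge_zero])
        finally show ?thesis using True by simp
      qed (simp add: assms(3))
    qed
  qed
qed

lemma inner_ball_normal_ge:
  fixes v x :: "real ^ 'n::finite"
  assumes "v $ j \<ge> c * norm v" "x $ j \<ge> 0" "ball_fun j c K x \<ge> 0" "c > 0" "K > 0"
  shows "v \<bullet> (x + K *\<^sub>R axis j 1) \<ge> K * c / 2 * norm v"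
proof -
  have "K * x $ j \<ge> 0" using assms by simp
  then have "(norm x)\<^sup>2 \<le> (K * c / 2)\<^sup>2"
    using assms(3) by (simp add: ball_fun_def dot_square_norm)
  then have "norm x \<le> K * c / 2"
    by (rule power2_le_imp_le) (use assms in simp)
  then have "norm v * norm x \<le> norm v * (K * c / 2)"
    by (rule mult_left_mono) simp
  moreover have "v \<bullet> x \<ge> - (norm v * norm x)"
    using Cauchy_Schwarz_ineq2[of v x] by linarith
  moreover have "K * v $ j \<ge> K * (c * norm v)"
    using assms by (simp add: mult_left_mono)
  ultimately show ?thesis
    by (simp add: inner_add_right inner_axis algebra_simps)
qed

text \<open>With \<open>g\<close> the gradient of the bump,
  \<open>- (\<eta> x \<bullet> g x)\<close> is nonnegative almost everywhere and has integral 0, so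
  it vanishes almost everywhere. It dominates \<open>norm (\<eta> x)\<close> times a weight that is
  positive in the ball.\<close>

lemma AE_zero_in_ball:
  fixes \<eta> :: "real ^ 'n::finite \<Rightarrow> real ^ 'n"
  assumes \<eta>: "\<eta> \<in> L_infinity"
    and lower: "AE x in lebesgue. x $ j < 0 \<longrightarrow> \<eta> x = 0"
    and div: "\<And>\<psi>. test_function \<psi> \<Longrightarrow> distr_div \<eta> \<psi> = 0"
    and cone: "AE x in lebesgue. \<eta> x $ j \<ge> c * norm (\<eta> x)"
    and pos: "c > 0" "K > 0"
  shows "AE x in lebesgue. ball_fun j c K x > 0 \<longrightarrow> \<eta> x = 0"
proof -
  define q where "q = ball_fun j c K"
  define g where "g = gradient (\<lambda>x. flat_exp 0 (q x))"
  have g: "g x = (- 2 * flat_exp 2 (q x)) *\<^sub>R (x + K *\<^sub>R axis j 1)" for x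
    unfolding g_def q_def by (rule gradient_flat_exp_ball_fun)
  have ineq: "AE x in lebesgue. K * c * flat_exp 2 (q x) * norm (\<eta> x) \<le> - (\<eta> x \<bullet> g x)"
    using lower cone
  proof eventually_elim
    case (elim x)
    show ?case
    \<comment> \<open>Both sides are 0 in the first case: either the field vanishes below the
      hyperplane, or \<open>flat_exp 2 (q x)\<close> vanishes outside the ball.\<close>
    proof (cases "x $ j < 0 \<or> q x < 0")
      case True
      with elim show ?thesis by (auto simp: g flat_exp_eq_0)
    next
      case False
      then have "\<eta> x \<bullet> (x + K *\<^sub>R axis j 1) \<ge> K * c / 2 * norm (\<eta> x)"
        using elim pos by (intro inner_ball_normal_ge) (auto simp: q_def)
      then have "2 * flat_exp 2 (q x) * (\<eta> x \<bullet> (x + K *\<^sub>R axis j 1))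
          \<ge> 2 * flat_exp 2 (q x) * (K * c / 2 * norm (\<eta> x))"
        by (intro mult_left_mono) (auto simp: flat_exp_nonneg)
      then show ?thesis by (simp add: g mult_ac)
    qed
  qed
  have "continuous_on UNIV (flat_exp 2)"
    using flat_exp_has_real_derivative
    by (intro DERIV_continuous_on) (auto intro: has_field_derivative_at_within)
  then have "continuous_on UNIV (\<lambda>x. flat_exp 2 (q x))"
    unfolding q_def ball_fun_def by (rule continuous_on_compose2) (auto intro!: continuous_intros)
  then have "continuous_on UNIV g"
    unfolding g by (auto simp: g intro!: continuous_intros)
  moreover have "g x = 0" if "norm x > 2 * K + K * c / 2" for x
    using that ball_fun_nonneg_imp_norm_le[OF _ pos, of j x] by (force simp: g q_def flat_exp_eq_0)
  ultimately have "integrable lebesgue (\<lambda>x. \<eta> x \<bullet> g x)"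
    by (rule integrable_inner_L_infinity[OF \<eta>])
  moreover have "(LINT x|lebesgue. - (\<eta> x \<bullet> g x)) = 0"
    using div[OF test_function_flat_exp_ball_fun[OF pos, of j]]
    by (simp add: distr_div_def g_def q_def)
  moreover have "AE x in lebesgue. 0 \<le> - (\<eta> x \<bullet> g x)"
    using ineq
  proof eventually_elim
    case (elim x)
    have "0 \<le> K * c * flat_exp 2 (q x) * norm (\<eta> x)"
      using pos by (simp add: flat_exp_nonneg)
    with elim show ?case by linarith
  qed
  ultimately have "AE x in lebesgue. - (\<eta> x \<bullet> g x) = 0"
    using integral_nonneg_eq_0_iff_AE[of lebesgue "\<lambda>x. - (\<eta> x \<bullet> g x)"] by simp
  with ineq show ?thesis
  proof eventually_elim
    case (elim x)
    show ?case
    proof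
      assume "ball_fun j c K x > 0"
      then have "K * c * flat_exp 2 (q x) > 0"
        using pos by (simp add: q_def flat_exp_pos)
      with elim show "\<eta> x = 0"
        by (metis mult_le_0_iff norm_le_zero_iff not_less)
    qed
  qed
qed

section \<open>Covering the space by the balls\<close>

text \<open>The positive term grows like \<open>K^2\<close>, the linear one only like
  \<open>K\<close>. Since \<open>K \<ge> 1\<close>, replacing \<open>x \<bullet> x\<close> by
  \<open>K * (x \<bullet> x)\<close> allows division by \<open>K\<close>, and
  \<open>K * c^2 / 4 > x \<bullet> x + 2 * x $ j\<close> suffices.\<close>

lemma exists_ball_fun_pos:
  fixes x :: "real ^ 'n::finite"
  assumes "c > 0"
  shows "\<exists>k::nat. ball_fun j c (Suc k) x > 0"
proof -
  obtain k :: nat where k: "(x \<bullet> x + 2 * x $ j) / (c\<^sup>2 / 4) < real k"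
    using reals_Archimedean2 by blast
  define K where "K = real (Suc k)"
  have "(x \<bullet> x + 2 * x $ j) / (c\<^sup>2 / 4) < K"
    using k by (simp add: K_def)
  then have "x \<bullet> x + 2 * x $ j < K * (c\<^sup>2 / 4)"
    using assms by (subst (asm) pos_divide_less_eq) auto
  then have "K * (x \<bullet> x + 2 * x $ j) < K * (K * (c\<^sup>2 / 4))"
    by (simp add: K_def)
  moreover have "1 * (x \<bullet> x) \<le> K * (x \<bullet> x)"
    by (rule mult_right_mono) (simp_all add: K_def)
  ultimately have "ball_fun j c K x > 0"
    by (simp add: ball_fun_def power2_eq_square algebra_simps)
  then show ?thesis unfolding K_def by blast
qed

theorem theorem1p2:
  fixes c :: real and \<phi> :: "real \<Rightarrow> real"
  assumes "CARD('n::{finite,linorder}) \<ge> 2"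
    and "c > 0"
    and "\<And>t. t \<ge> 0 \<Longrightarrow> \<phi> t = c * t"
  shows "phi_rigidity TYPE('n) \<phi>"
  unfolding phi_rigidity_def
proof (intro allI impI)
  fix \<eta> :: "real ^ 'n::{finite,linorder} \<Rightarrow> real ^ 'n::{finite,linorder}"
  assume \<eta>: "\<eta> \<in> L_infinity"
    and lower: "AE x in lebesgue. x $ last_index < 0 \<longrightarrow> \<eta> x = 0"
    and div: "\<forall>\<psi>. test_function \<psi> \<longrightarrow> distr_div \<eta> \<psi> = 0"
    and cone: "AE x in lebesgue. \<eta> x $ last_index \<ge> \<phi> (norm (\<eta> x))"
  have "AE x in lebesgue. ball_fun last_index c (Suc k) x > 0 \<longrightarrow> \<eta> x = 0" for k
    using \<eta> lower div cone assms(2,3) by (intro AE_zero_in_ball) auto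
  \<comment> \<open>Restricting \<open>K\<close> to positive integers leaves countably many
    exceptional null sets, whose union is null.\<close>
  then have "AE x in lebesgue. \<forall>k. ball_fun last_index c (Suc k) x > 0 \<longrightarrow> \<eta> x = 0"
    by (subst AE_all_countable) blast
  then show "AE x in lebesgue. \<eta> x = 0"
    using exists_ball_fun_pos[OF assms(2)] by (elim eventually_mono) blast
qed

end
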